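(* Let $K$ be an algebraically closed field and $f(s_1,\dots,s_n)=\frac{a}{a_1^{s_1}\cdots a_n^{s_n}}+\frac{b}{b_1^{s_1}\cdots b_n^{s_n}}$ with $a,b\in K$, $ab\ne0$, positive integers $a_i,b_i$, and $a_i$ coprime to $b_i$ for each $i\in\{1,\dots,n\}$. Then $f$ is absolutely irreducible if and only if the multiplicities of all the primes appearing in the prime factorizations of $a_1,\dots,a_n,b_1,\dots,b_n$ are relatively prime.
   Context: Multivariate Dirichlet polynomials over $K$ are finite sums $\sum\frac{c_{i_1,\dots,i_n}}{i_1^{s_1}\cdots i_n^{s_n}}$ ($i_j$ positive integers) with product given by $\frac{c}{j_1^{s_1}\cdots j_n^{s_n}}\cdot\frac{d}{k_1^{s_1}\cdots k_n^{s_n}}=\frac{cd}{(j_1k_1)^{s_1}\cdots(j_nk_n)^{s_n}}$ extended bilinearly; a constant is one supported on $\{(1,\dots,1)\}$. $f$ is absolutely irreducible if it is not a product of two nonconstant multivariate Dirichlet polynomials with coefficients in the algebraically closed field $K$.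
   Formalization: "Absolutely irreducible" is taken to require also that f is nonconstant; this matters only when all a_i = b_i = 1, where f is constant and there are no multiplicities, so the literal equivalence fails. *)

theory Defs
  imports
    "HOL-Library.Poly_Mapping"
    "HOL-Computational_Algebra.Computational_Algebra"
begin

text \<open>
  Tuples \<open>(i\<^sub>1, \<dots>, i\<^sub>n)\<close> of positive integers, indexed by a type of cardinality \<open>n\<close>.
  They form an additive monoid whose \<open>+\<close> is componentwise multiplication and whose \<open>0\<close>
  is \<open>(1, \<dots>, 1)\<close>: the product of the library type \<open>_ \<Rightarrow>\<^sub>0 _\<close> is convolution with
  respect to \<open>+\<close> on the keys, so with these keys it is multivariate Dirichlet convolution.
\<close>

typedef 'n pos_tuple = "{j :: 'n \<Rightarrow> nat. \<forall>i. j i > 0}"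
  morphisms component Pos_tuple
  by (rule exI[of _ "\<lambda>_. 1"]) simp

setup_lifting type_definition_pos_tuple

instantiation pos_tuple :: (type) comm_monoid_add
begin

lift_definition zero_pos_tuple :: "'a pos_tuple" is "\<lambda>_. 1"
  by simp

lift_definition plus_pos_tuple :: "'a pos_tuple \<Rightarrow> 'a pos_tuple \<Rightarrow> 'a pos_tuple"
  is "\<lambda>j k i. j i * k i"
  by simp

instance
  by standard (transfer; simp add: ac_simps)+

end

text \<open>
  A key \<open>j\<close> with coefficient \<open>c\<close> stands for the term
  \<open>c / (j\<^sub>1 ^ s\<^sub>1 \<cdots> j\<^sub>n ^ s\<^sub>n)\<close>.
\<close>

type_synonym ('n, 'k) dirichlet_poly = "'n pos_tuple \<Rightarrow>\<^sub>0 'k"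

text \<open>Meaningful only if all \<open>j i\<close> are positive, as \<open>Pos_tuple\<close> is unspecified otherwise.\<close>

definition dirichlet_term :: "'k::zero \<Rightarrow> ('n \<Rightarrow> nat) \<Rightarrow> ('n, 'k) dirichlet_poly" where
  "dirichlet_term c j = Poly_Mapping.single (Pos_tuple j) c"

lemma dirichlet_term_mult:
  fixes c d :: "'k::comm_semiring_0"
  assumes "\<And>i. j i > 0" and "\<And>i. k i > 0"
  shows "dirichlet_term c j * dirichlet_term d k = dirichlet_term (c * d) (\<lambda>i. j i * k i)"
  using assms by (simp add: dirichlet_term_def mult_single plus_pos_tuple.abs_eq eq_onp_def)

definition constant_dirichlet :: "('n, 'k::zero) dirichlet_poly \<Rightarrow> bool" where
  "constant_dirichlet f \<longleftrightarrow> Poly_Mapping.keys f \<subseteq> {Pos_tuple (\<lambda>_. 1)}"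

text \<open>
  As usual for irreducibility, constants are excluded: they are zero or units of the ring of
  Dirichlet polynomials.
\<close>

definition absolutely_irreducible :: "('n, 'k::alg_closed_field) dirichlet_poly \<Rightarrow> bool" where
  "absolutely_irreducible f \<longleftrightarrow>
     \<not> constant_dirichlet f \<and>
     \<not> (\<exists>g h. \<not> constant_dirichlet g \<and> \<not> constant_dirichlet h \<and> f = g * h)"

end

theory Submission
  imports Defs
begin

text \<open>
  If \<open>d > 1\<close> divides all multiplicities, both terms are \<open>d\<close>-th powers up to constants that have
  \<open>d\<close>-th roots, and \<open>x ^ d - y ^ d\<close> splits off \<open>x - y\<close>.

  Conversely, view keys as exponent vectors. For every integer-valued linear weight, the spread
  (largest minus smallest value on the keys) of a product is the sum of the spreads of its
  factors. Let \<open>v\<close> be the difference of the exponent vectors of the two terms. Because of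
  coprimality its entries are the multiplicities up to sign, so if these are relatively prime,
  Bezout gives a weight \<open>w\<close> with value 1 at \<open>v\<close>. Hence \<open>w\<close> is constant on the keys of one of two
  factors; each coordinate minus a multiple of \<open>w\<close> vanishes at \<open>v\<close> and so is constant on both.
  Thus one factor is a single term, which divides two coprime terms and so is constant.
\<close>

section \<open>Tuples, prime exponents and additive weights\<close>

lemma component_plus: "component (x + y) i = component x i * component y i"
  by (simp add: plus_pos_tuple.rep_eq)

lemma component_zero: "component 0 i = 1"
  by (simp add: zero_pos_tuple.rep_eq)

lemma component_pos: "component x i > 0"
  using component[of x] by simp

lemma pos_tuple_eqI: "(\<And>i. component x i = component y i) \<Longrightarrow> x = y"
  by (simp add: component_inject[symmetric] fun_eq_iff)

lemma component_Pos_tuple: "(\<And>i. j i > 0) \<Longrightarrow> component (Pos_tuple j) i = j i"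
  by (simp add: Pos_tuple_inverse)

lemma constant_dirichlet_iff: "constant_dirichlet f \<longleftrightarrow> Poly_Mapping.keys f \<subseteq> {0}"
  by (simp add: constant_dirichlet_def zero_pos_tuple_def)

text \<open>These are the linear functionals on exponent vectors, encoded as homomorphisms on the
  monoid of keys so that the vectors themselves need not be formed.\<close>

definition additive_weight :: "('n pos_tuple \<Rightarrow> int) \<Rightarrow> bool" where
  "additive_weight w \<longleftrightarrow> (\<forall>x y. w (x + y) = w x + w y)"

lemma additive_weight_linear_combination:
  assumes "additive_weight u" and "additive_weight w"
  shows "additive_weight (\<lambda>x. r * u x + s * w x)"
  using assms by (simp add: additive_weight_def algebra_simps)

definition exponent :: "nat \<Rightarrow> 'n \<Rightarrow> 'n pos_tuple \<Rightarrow> int" where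
  "exponent p i x = int (multiplicity p (component x i))"

lemma additive_weight_exponent: "prime p \<Longrightarrow> additive_weight (exponent p i)"
  by (auto simp: additive_weight_def exponent_def component_plus component_pos
      prime_elem_multiplicity_mult_distrib less_imp_neq[OF component_pos, symmetric])

lemma pos_tuple_eq_exponentI:
  assumes "\<And>p i. prime p \<Longrightarrow> exponent p i x = exponent p i y"
  shows "x = y"
proof (rule pos_tuple_eqI)
  fix i
  have "multiplicity p (component x i) = multiplicity p (component y i)" if "prime p" for p
    using assms[OF that, of i] by (simp add: exponent_def)
  then show "component x i = component y i"
    by (rule multiplicity_eq_nat[OF component_pos component_pos])
qed

section \<open>Extremal keys of a product and additivity of spreads\<close>

lemma finite_argmax_nonempty:
  fixes f :: "'a \<Rightarrow> 'b::linorder"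
  assumes "finite A" and "A \<noteq> {}"
  shows "{x \<in> A. \<forall>x'\<in>A. f x' \<le> f x} \<noteq> {}"
proof -
  have "Max (f ` A) \<in> f ` A"
    using assms by simp
  then obtain x where "x \<in> A" "f x = Max (f ` A)"
    by auto
  moreover from this have "\<forall>x'\<in>A. f x' \<le> f x"
    using assms by simp
  ultimately show ?thesis
    by blast
qed

lemma mult_eq_mult_boundedD:
  fixes k l m n :: nat
  assumes "k \<le> m" "l \<le> n" "k * l = m * n" "0 < k" "0 < l"
  shows "k = m \<and> l = n"
proof -
  have "k * l \<le> k * n" "k * n \<le> m * n"
    by (rule mult_le_mono; simp add: assms)+
  then have "k * l = k * n" "k * n = m * n"
    using assms(3) by linarith+
  then show ?thesis
    using assms by (metis mult_cancel1 mult_cancel2 mult_is_0 less_not_refl)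
qed

text \<open>
  Refining the pair to be maximal in one coordinate after the other amounts to comparing
  tuples lexicographically, without choosing an order on the index type.
\<close>

lemma unique_sum_on_coordinates:
  fixes A B :: "'n pos_tuple set"
  assumes "finite I" and "finite A" "A \<noteq> {}" and "finite B" "B \<noteq> {}"
  shows "\<exists>x\<in>A. \<exists>y\<in>B. \<forall>x'\<in>A. \<forall>y'\<in>B. x' + y' = x + y \<longrightarrow>
           (\<forall>i\<in>I. component x' i = component x i \<and> component y' i = component y i)"
  using assms
proof (induction I arbitrary: A B rule: finite_induct)
  case empty
  then show ?case by blast
next
  case (insert i I)
  define A' where "A' = {x \<in> A. \<forall>x'\<in>A. component x' i \<le> component x i}"
  define B' where "B' = {y \<in> B. \<forall>y'\<in>B. component y' i \<le> component y i}"
  have "A' \<noteq> {}" "B' \<noteq> {}" "finite A'" "finite B'"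
    using insert.prems finite_argmax_nonempty[of A "\<lambda>x. component x i"]
      finite_argmax_nonempty[of B "\<lambda>x. component x i"]
    by (simp_all add: A'_def B'_def)
  then obtain x y where xy: "x \<in> A'" "y \<in> B'"
    and uniq: "\<And>x' y'. x' \<in> A' \<Longrightarrow> y' \<in> B' \<Longrightarrow> x' + y' = x + y \<Longrightarrow>
           (\<forall>i\<in>I. component x' i = component x i \<and> component y' i = component y i)"
    using insert.IH[of A' B'] by metis
  have "\<forall>k\<in>insert i I. component x' k = component x k \<and> component y' k = component y k"
    if *: "x' \<in> A" "y' \<in> B" "x' + y' = x + y" for x' y'
  proof -
    \<comment> \<open>A product of two maxima is attained only by maxima, so a competing pair stays
      in \<open>A'\<close> and \<open>B'\<close>, where the induction hypothesis applies.\<close>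
    have "component x' i * component y' i = component x i * component y i"
      using * by (metis component_plus)
    then have eq: "component x' i = component x i \<and> component y' i = component y i"
      using * xy by (intro mult_eq_mult_boundedD) (auto simp: A'_def B'_def component_pos)
    then have "x' \<in> A'" "y' \<in> B'"
      using * xy by (auto simp: A'_def B'_def)
    then show ?thesis
      using uniq * eq by blast
  qed
  moreover have "x \<in> A" "y \<in> B"
    using xy by (auto simp: A'_def B'_def)
  ultimately show ?case
    by blast
qed

text \<open>No other pair of keys contributes to the convolution at \<open>x + y\<close>, so nothing
  can cancel there.\<close>

lemma lookup_mult_unique_sum:
  fixes g h :: "'a::comm_monoid_add \<Rightarrow>\<^sub>0 'k::semiring_0"
  assumes "\<And>x' y'. x' \<in> Poly_Mapping.keys g \<Longrightarrow> y' \<in> Poly_Mapping.keys h \<Longrightarrow>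
             x' + y' = x + y \<Longrightarrow> x' = x \<and> y' = y"
  shows "Poly_Mapping.lookup (g * h) (x + y) = Poly_Mapping.lookup g x * Poly_Mapping.lookup h y"
proof -
  let ?g = "Poly_Mapping.lookup g" and ?h = "Poly_Mapping.lookup h"
  \<comment> \<open>If \<open>x + y = u + v\<close> and both coefficients are nonzero, then
    \<open>(u, v)\<close> is \<open>(x, y)\<close>. All other summands are 0, which leaves a sum
    supported at one point.\<close>
  have "(?g u * ?h v when x + y = u + v) = (?g x * ?h y when (x, y) = (u, v))" for u v
    using assms[of u v] by (cases "?g u = 0"; cases "?h v = 0") (auto simp: when_def in_keys_iff)
  then have "(\<Sum>(u, v). ?g u * ?h v when x + y = u + v)
      = (\<Sum>z. ?g x * ?h y when (x, y) = z)"
    by (simp add: case_prod_unfold del: prod.inject)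
  also have "\<dots> = ?g x * ?h y"
    by simp
  finally have "(\<Sum>(u, v). ?g u * ?h v when x + y = u + v) = ?g x * ?h y" .
  then show ?thesis
    by (simp add: times_poly_mapping.rep_eq prod_fun_unfold_prod)
qed

text \<open>Many keys may share the maximal weight, so their leading terms might cancel. Among them
  a pair with a unique sum is chosen; its coefficient in the product is a product of nonzero
  coefficients.\<close>

lemma ex_max_weight_key_mult:
  fixes g h :: "('n::finite, 'k::semiring_no_zero_divisors) dirichlet_poly"
  assumes "g \<noteq> 0" and "h \<noteq> 0" and w: "additive_weight w"
  shows "\<exists>x\<in>Poly_Mapping.keys g. \<exists>y\<in>Poly_Mapping.keys h. x + y \<in> Poly_Mapping.keys (g * h) \<and>
    (\<forall>x'\<in>Poly_Mapping.keys g. w x' \<le> w x) \<and> (\<forall>y'\<in>Poly_Mapping.keys h. w y' \<le> w y)"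
proof -
  define A where "A = {x \<in> Poly_Mapping.keys g. \<forall>x'\<in>Poly_Mapping.keys g. w x' \<le> w x}"
  define B where "B = {y \<in> Poly_Mapping.keys h. \<forall>y'\<in>Poly_Mapping.keys h. w y' \<le> w y}"
  have "A \<noteq> {}" "B \<noteq> {}" "finite A" "finite B"
    using assms finite_argmax_nonempty[of "Poly_Mapping.keys g" w]
      finite_argmax_nonempty[of "Poly_Mapping.keys h" w]
    by (simp_all add: A_def B_def)
  then obtain x y where xy: "x \<in> A" "y \<in> B"
    and uniq: "\<And>x' y' i. x' \<in> A \<Longrightarrow> y' \<in> B \<Longrightarrow> x' + y' = x + y \<Longrightarrow>
           component x' i = component x i \<and> component y' i = component y i"
    using unique_sum_on_coordinates[of "UNIV :: 'n set" A B] by (metis UNIV_I finite)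
  have "x' = x \<and> y' = y"
    if *: "x' \<in> Poly_Mapping.keys g" "y' \<in> Poly_Mapping.keys h" "x' + y' = x + y" for x' y'
  proof -
    \<comment> \<open>Weights add up and neither one exceeds its maximum, so a competing pair must
      also have maximal weights.\<close>
    have "w x' + w y' = w x + w y"
      using w * by (metis additive_weight_def)
    moreover have "w x' \<le> w x" "w y' \<le> w y"
      using * xy by (auto simp: A_def B_def)
    ultimately have "w x' = w x" "w y' = w y"
      by linarith+
    then have "x' \<in> A" "y' \<in> B"
      using * xy by (auto simp: A_def B_def)
    then show ?thesis
      using uniq * by (blast intro: pos_tuple_eqI)
  qed
  then have "Poly_Mapping.lookup (g * h) (x + y)
      = Poly_Mapping.lookup g x * Poly_Mapping.lookup h y"
    by (rule lookup_mult_unique_sum)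
  moreover have "x \<in> Poly_Mapping.keys g" "y \<in> Poly_Mapping.keys h"
    using xy by (auto simp: A_def B_def)
  ultimately have "x + y \<in> Poly_Mapping.keys (g * h)"
    by (simp add: in_keys_iff)
  then show ?thesis
    using xy by (auto simp: A_def B_def)
qed

text \<open>The extreme weights on the product are sums of the extreme weights on the factors:
  maxima come from \<open>w\<close>, minima from \<open>- w\<close>. Quantifying over arbitrary keys
  avoids naming the extrema.\<close>

lemma weight_spread_mult:
  fixes g h :: "('n::finite, 'k::semiring_no_zero_divisors) dirichlet_poly"
  assumes "g \<noteq> 0" and "h \<noteq> 0" and "additive_weight w"
    and bound: "\<And>x y. x \<in> Poly_Mapping.keys (g * h) \<Longrightarrow> y \<in> Poly_Mapping.keys (g * h) \<Longrightarrow>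
      w x - w y \<le> m"
    and "x \<in> Poly_Mapping.keys g" "x' \<in> Poly_Mapping.keys g"
    and "y \<in> Poly_Mapping.keys h" "y' \<in> Poly_Mapping.keys h"
  shows "(w x - w x') + (w y - w y') \<le> m"
proof -
  have neg: "additive_weight (\<lambda>x. - w x)"
    using assms by (simp add: additive_weight_def)
  obtain s t where st: "s + t \<in> Poly_Mapping.keys (g * h)"
    "\<And>x. x \<in> Poly_Mapping.keys g \<Longrightarrow> w x \<le> w s" "\<And>y. y \<in> Poly_Mapping.keys h \<Longrightarrow> w y \<le> w t"
    using ex_max_weight_key_mult[OF assms(1-3)] by blast
  obtain s' t' where st': "s' + t' \<in> Poly_Mapping.keys (g * h)"
    "\<And>x. x \<in> Poly_Mapping.keys g \<Longrightarrow> w s' \<le> w x" "\<And>y. y \<in> Poly_Mapping.keys h \<Longrightarrow> w t' \<le> w y"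
    using ex_max_weight_key_mult[OF assms(1,2) neg] by auto
  have "w s + w t - (w s' + w t') \<le> m"
    using bound[OF st(1) st'(1)] assms(3) by (simp add: additive_weight_def)
  then show ?thesis
    using st(2)[of x] st(3)[of y] st'(2)[of x'] st'(3)[of y'] assms(5-) by linarith
qed

section \<open>Bezout weights and the factors of a binomial\<close>

text \<open>Additive weights are closed under integer linear combinations, so Bezout can be applied
  to one element at a time.\<close>

lemma ex_weight_diff_Gcd:
  assumes "finite S"
    and "\<And>s. s \<in> S \<Longrightarrow> \<exists>w. additive_weight w \<and> w x - w y = int s"
  shows "\<exists>w. additive_weight w \<and> w x - w y = int (Gcd S)"
  using assms
proof (induction S rule: finite_induct)
  case empty
  have "additive_weight (\<lambda>_. 0)"
    by (simp add: additive_weight_def)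
  then show ?case
    by (intro exI[of _ "\<lambda>_. 0"]) simp
next
  case (insert s S)
  then obtain u w where "additive_weight u" "u x - u y = int s"
    and "additive_weight w" "w x - w y = int (Gcd S)"
    by (metis insertI1 insertI2)
  moreover obtain k l where "k * int s + l * int (Gcd S) = gcd (int s) (int (Gcd S))"
    using bezout_int by blast
  moreover have "(k * u x + l * w x) - (k * u y + l * w y) = k * (u x - u y) + l * (w x - w y)"
    by (simp add: algebra_simps)
  ultimately have "(k * u x + l * w x) - (k * u y + l * w y) = int (Gcd (insert s S))"
    by simp
  then show ?case
    using additive_weight_linear_combination \<open>additive_weight u\<close> \<open>additive_weight w\<close> by blast
qed

text \<open>Every key of the product is \<open>z\<close> plus a key of \<open>h\<close>, so each
  component of \<open>z\<close> divides the corresponding components of both \<open>x\<close> and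
  \<open>y\<close>.\<close>

lemma single_factor_constant:
  fixes g h :: "('n, 'k::semiring_0) dirichlet_poly"
  assumes "Poly_Mapping.keys g \<subseteq> {z}"
    and "x \<in> Poly_Mapping.keys (g * h)" "y \<in> Poly_Mapping.keys (g * h)"
    and "\<And>i. coprime (component x i) (component y i)"
  shows "constant_dirichlet g"
proof -
  have dvd: "component z i dvd component u i" if "u \<in> Poly_Mapping.keys (g * h)" for u i
    using that keys_mult[of g h] assms(1) by (fastforce simp: component_plus)
  have "component z i = 1" for i
    using dvd assms(2-4) by (meson coprime_common_divisor_nat)
  then have "z = 0"
    by (intro pos_tuple_eqI) (simp add: component_zero)
  then show ?thesis
    using assms(1) by (simp add: constant_dirichlet_iff)
qed

lemma factor_constant_if_weight_diff_1:
  fixes g h :: "('n::finite, 'k::idom) dirichlet_poly"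
  assumes keys: "Poly_Mapping.keys (g * h) = {x, y}"
    and coprime: "\<And>i. coprime (component x i) (component y i)"
    and w: "additive_weight w" "w x - w y = 1"
  shows "constant_dirichlet g \<or> constant_dirichlet h"
proof -
  have nz: "g \<noteq> 0" "h \<noteq> 0"
    using keys by auto
  then obtain s t where st: "s \<in> Poly_Mapping.keys g" "t \<in> Poly_Mapping.keys h"
    by (metis keys_eq_empty all_not_in_conv)
  have exps: "exponent p i u - exponent p i u' = (exponent p i x - exponent p i y) * (w u - w u')"
    if "prime p" and u: "u \<in> Poly_Mapping.keys g \<and> u' \<in> Poly_Mapping.keys g \<or>
      u \<in> Poly_Mapping.keys h \<and> u' \<in> Poly_Mapping.keys h" for p i u u'
  proof -
    define c where "c = exponent p i x - exponent p i y"
    \<comment> \<open>Subtracting \<open>c\<close> times \<open>w\<close> cancels the difference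
      between \<open>x\<close> and \<open>y\<close>, so \<open>v\<close> has spread 0 on the product
      and hence on each factor.\<close>
    define v where "v = (\<lambda>z. 1 * exponent p i z + (- c) * w z)"
    have v: "additive_weight v"
      unfolding v_def
      by (intro additive_weight_linear_combination additive_weight_exponent w \<open>prime p\<close>)
    have "v x - v y = c - c * (w x - w y)"
      by (simp add: v_def c_def algebra_simps)
    then have "v x = v y"
      using w by simp
    then have le: "(v a - v a') + (v b - v b') \<le> 0"
      if "a \<in> Poly_Mapping.keys g" "a' \<in> Poly_Mapping.keys g"
        "b \<in> Poly_Mapping.keys h" "b' \<in> Poly_Mapping.keys h" for a a' b b'
      by (intro weight_spread_mult[OF nz v _ that]) (auto simp: keys)
    \<comment> \<open>Using the same key twice in the other factor isolates one spread; both orders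
      of \<open>u\<close> and \<open>u'\<close> give equality.\<close>
    have "v u = v u'"
      using u le[of u u' t t] le[of u' u t t] le[of s s u u'] le[of s s u' u] st by force
    then show ?thesis
      by (simp add: v_def c_def algebra_simps)
  qed
  have eqI: "u = u'"
    if "w u = w u'" "u \<in> Poly_Mapping.keys g \<and> u' \<in> Poly_Mapping.keys g \<or>
      u \<in> Poly_Mapping.keys h \<and> u' \<in> Poly_Mapping.keys h" for u u'
    using exps[OF _ that(2)] that(1) by (intro pos_tuple_eq_exponentI) simp
  have le: "(w a - w a') + (w b - w b') \<le> 1"
    if "a \<in> Poly_Mapping.keys g" "a' \<in> Poly_Mapping.keys g"
      "b \<in> Poly_Mapping.keys h" "b' \<in> Poly_Mapping.keys h" for a a' b b'
    using w(2) by (intro weight_spread_mult[OF nz w(1) _ that]) (auto simp: keys)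
  have "(\<forall>u\<in>Poly_Mapping.keys g. w u = w s) \<or> (\<forall>u\<in>Poly_Mapping.keys h. w u = w t)"
  proof (rule ccontr)
    assume "\<not> ?thesis"
    then obtain u u' where u: "u \<in> Poly_Mapping.keys g" "w u \<noteq> w s"
      and u': "u' \<in> Poly_Mapping.keys h" "w u' \<noteq> w t"
      by blast
    \<comment> \<open>Weights are integers, so two nonzero spreads would sum to at least 2. The four
      instances cover the possible signs.\<close>
    show False
      using u u' st le[of u s u' t] le[of u s t u'] le[of s u u' t] le[of s u t u'] by linarith
  qed
  then have "Poly_Mapping.keys g \<subseteq> {s} \<or> Poly_Mapping.keys h \<subseteq> {t}"
    using eqI st by blast
  then show ?thesis
  proof
    assume "Poly_Mapping.keys g \<subseteq> {s}"
    then show ?thesis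
      using single_factor_constant[of g s x h y] keys coprime by simp
  next
    assume h: "Poly_Mapping.keys h \<subseteq> {t}"
    have "Poly_Mapping.keys (h * g) = {x, y}"
      using keys by (simp add: mult.commute)
    then show ?thesis
      using single_factor_constant[of h t x g y] h coprime by simp
  qed
qed

section \<open>Splitting binomials of \<open>d\<close>-th powers\<close>

lemma dirichlet_term_power:
  assumes "\<And>i. j i > 0"
  shows "dirichlet_term (c::'k::comm_semiring_1) j ^ d = dirichlet_term (c ^ d) (\<lambda>i. j i ^ d)"
proof (induction d)
  case 0
  show ?case
    by (simp add: dirichlet_term_def zero_pos_tuple_def[unfolded One_nat_def, symmetric])
next
  case (Suc d)
  then show ?case
    using assms by (simp add: dirichlet_term_mult)
qed

lemma keys_dirichlet_term: "c \<noteq> 0 \<Longrightarrow> Poly_Mapping.keys (dirichlet_term c j) = {Pos_tuple j}"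
  by (simp add: dirichlet_term_def)

lemma keys_dirichlet_binomial:
  fixes a b :: "'k::monoid_add"
  assumes "a \<noteq> 0" "b \<noteq> 0" "Pos_tuple as \<noteq> Pos_tuple bs"
  shows "Poly_Mapping.keys (dirichlet_term a as + dirichlet_term b bs)
    = {Pos_tuple as, Pos_tuple bs}"
  using assms by (auto simp: dirichlet_term_def in_keys_iff lookup_add lookup_single when_def
      split: if_splits)

text \<open>This rules out, outside the trivial tuples, that raising both keys of a binomial to the
  power \<open>d\<close> leads back to those keys.\<close>

lemma power_eq_coprimeD:
  fixes m n :: nat
  assumes "m ^ d = m \<or> m ^ d = n" "coprime m n" "m > 0" "d > 1"
  shows "m = 1"
  using assms(1)
proof
  assume "m ^ d = m"
  then have "m ^ d = m ^ 1"
    by simp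
  then show ?thesis
    using \<open>m > 0\<close> \<open>d > 1\<close> power_inject_exp[of m d 1] by fastforce
next
  assume "m ^ d = n"
  then have "m dvd n"
    using \<open>d > 1\<close> by (auto intro: dvd_power)
  then show ?thesis
    using \<open>coprime m n\<close> by (metis coprime_common_divisor_nat dvd_refl)
qed

lemma not_absolutely_irreducible_power_binomial:
  fixes a b :: "'k::alg_closed_field" and as bs :: "'n \<Rightarrow> nat"
  assumes ab: "a \<noteq> 0" "b \<noteq> 0" and "d > 1"
    and pos: "\<And>i. as i > 0" "\<And>i. bs i > 0"
    and coprime: "\<And>i. coprime (as i) (bs i)"
  shows "\<not> absolutely_irreducible
    (dirichlet_term a (\<lambda>i. as i ^ d) + dirichlet_term b (\<lambda>i. bs i ^ d))"
    (is "\<not> absolutely_irreducible ?f")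
proof (cases "Pos_tuple as = Pos_tuple bs")
  case True
  then have "as = bs"
    using pos by (simp add: Pos_tuple_inject)
  \<comment> \<open>A number coprime to itself is 1, so the two terms collapse to a constant, which
    is excluded by definition.\<close>
  then have "as = (\<lambda>_. 1)" "bs = (\<lambda>_. 1)"
    using coprime by auto
  then have "Poly_Mapping.keys ?f \<subseteq> {0}"
    using keys_add[of "dirichlet_term a (\<lambda>i. as i ^ d)" "dirichlet_term b (\<lambda>i. bs i ^ d)"]
    by (simp add: keys_dirichlet_term ab zero_pos_tuple_def)
  then show ?thesis
    by (simp add: absolutely_irreducible_def constant_dirichlet_iff)
next
  case False
  \<comment> \<open>Absorbing the sign into \<open>b'\<close> makes \<open>?f\<close> a difference
    of \<open>d\<close>-th powers whatever the parity of \<open>d\<close>.\<close>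
  obtain a' b' where roots: "a' ^ d = a" "b' ^ d = - b"
    using \<open>d > 1\<close> nth_root_exists[of d] by (metis less_trans zero_less_one)
  then have nz: "a' \<noteq> 0" "- b' \<noteq> 0"
    using ab \<open>d > 1\<close> by (auto simp: power_0_left)
  define x y where "x = dirichlet_term a' as" and "y = dirichlet_term b' bs"
  define g where "g = x - y"
  define h where "h = (\<Sum>i<d. y ^ (d - Suc i) * x ^ i)"
  have "?f = x ^ d - y ^ d"
    using pos roots by (simp add: x_def y_def dirichlet_term_power)
      (simp add: dirichlet_term_def single_uminus)
  then have f: "?f = g * h"
    by (simp add: g_def h_def power_diff_sumr2)
  have "g = dirichlet_term a' as + dirichlet_term (- b') bs"
    by (simp add: g_def x_def y_def dirichlet_term_def single_uminus)
  then have keys_g: "Poly_Mapping.keys g = {Pos_tuple as, Pos_tuple bs}"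
    using keys_dirichlet_binomial[OF nz False] by simp
  have "\<not> constant_dirichlet g"
    using False keys_g by (auto simp: constant_dirichlet_iff)
  moreover have "\<not> constant_dirichlet h"
  proof
    assume "constant_dirichlet h"
    \<comment> \<open>Multiplying by a constant creates no new keys. Comparing keys shows that
      \<open>h\<close> is not constant without expanding it, in any characteristic.\<close>
    then have "Poly_Mapping.keys ?f \<subseteq> {Pos_tuple as, Pos_tuple bs}"
      using keys_mult[of g h] unfolding f keys_g constant_dirichlet_iff by fastforce
    moreover have "Pos_tuple (\<lambda>i. as i ^ d) \<noteq> Pos_tuple (\<lambda>i. bs i ^ d)"
      using False \<open>d > 1\<close> pos
      by (auto simp: Pos_tuple_inject fun_eq_iff power_eq_iff_eq_base)
    ultimately have "Pos_tuple (\<lambda>i. as i ^ d) \<in> {Pos_tuple as, Pos_tuple bs}"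
      and "Pos_tuple (\<lambda>i. bs i ^ d) \<in> {Pos_tuple as, Pos_tuple bs}"
      using keys_dirichlet_binomial[OF ab] by auto
    then have "(\<lambda>i. as i ^ d) = as \<or> (\<lambda>i. as i ^ d) = bs"
      and "(\<lambda>i. bs i ^ d) = bs \<or> (\<lambda>i. bs i ^ d) = as"
      using pos by (auto simp: Pos_tuple_inject)
    then have "as i ^ d = as i \<or> as i ^ d = bs i" and "bs i ^ d = bs i \<or> bs i ^ d = as i" for i
      by (metis (no_types))+
    then have "as i = 1" and "bs i = 1" for i
      using power_eq_coprimeD coprime coprime_commute pos \<open>d > 1\<close> by blast+
    then show False
      using False by presburger
  qed
  ultimately show ?thesis
    using f unfolding absolutely_irreducible_def by blast
qed

section \<open>From multiplicities to weights and roots\<close>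

lemma ex_weight_diff_multiplicity:
  assumes "prime p" and "coprime (component x i) (component y i)"
  shows "\<exists>w. additive_weight w \<and> w x - w y = int (multiplicity p (component x i))"
proof (cases "p dvd component x i")
  case True
  then have "\<not> p dvd component y i"
    using assms by (meson coprime_common_divisor not_prime_unit)
  then have "exponent p i x - exponent p i y = int (multiplicity p (component x i))"
    by (simp add: exponent_def not_dvd_imp_multiplicity_0)
  then show ?thesis
    by (intro exI[of _ "exponent p i"] conjI additive_weight_exponent \<open>prime p\<close>)
next
  \<comment> \<open>Here \<open>p\<close> may divide \<open>component y i\<close>, so
    \<open>exponent p i\<close> could give a nonzero difference; the zero weight gives the required
    0.\<close>
  case False
  have "additive_weight (\<lambda>_. 0)"
    by (simp add: additive_weight_def)
  then show ?thesis
    using False by (intro exI[of _ "\<lambda>_. 0"]) (simp add: not_dvd_imp_multiplicity_0)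
qed

lemma ex_power_roots:
  fixes j :: "'n \<Rightarrow> nat"
  assumes "d > 0" and "\<And>p i. p \<in> prime_factors (j i) \<Longrightarrow> d dvd multiplicity p (j i)"
    and "\<And>i. j i > 0"
  shows "\<exists>k. (\<forall>i. k i > 0) \<and> j = (\<lambda>i. k i ^ d)"
proof -
  \<comment> \<open>Primes outside the factorization have multiplicity 0, so the divisibility
    extends to all primes, as the criterion for \<open>d\<close>-th powers demands.\<close>
  have "d dvd multiplicity p (j i)" if "prime p" for p i
    using assms(2)[of p i] assms(3)[of i] that
    by (cases "p dvd j i") (auto simp: in_prime_factors_iff not_dvd_imp_multiplicity_0)
  then have "is_nth_power d (j i)" for i
    using \<open>d > 0\<close> by (simp add: is_nth_power_conv_multiplicity_nat)
  then have "\<forall>i. \<exists>k. j i = k ^ d"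
    by (simp add: is_nth_power_def)
  then obtain k where k: "j i = k i ^ d" for i
    by metis
  then have "k i > 0" for i
    using assms(3)[of i] \<open>d > 0\<close> by (cases "k i") (auto simp: power_0_left)
  then show ?thesis
    by (intro exI[of _ k]) (simp add: k fun_eq_iff)
qed

text \<open>The value 0 needs its own case: it arises from the empty set, that is, when all
  components of both tuples are 1. Then any \<open>d\<close> will do, such as 2.\<close>

lemma ex_common_divisor_gt_1:
  fixes S :: "nat set"
  assumes "Gcd S \<noteq> 1"
  shows "\<exists>d>1. \<forall>s\<in>S. d dvd s"
proof (cases "Gcd S = 0")
  case True
  then have "\<forall>s\<in>S. 2 dvd s"
    by (auto simp: Gcd_0_iff)
  then show ?thesis
    by (intro exI[of _ 2]) simp
next
  case False
  then have "Gcd S > 1"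
    using assms by linarith
  then show ?thesis
    by (blast intro: Gcd_dvd)
qed

lemma finite_multiplicities:
  fixes j :: "'n::finite \<Rightarrow> nat"
  shows "finite {multiplicity p (j i) | p i. p \<in> prime_factors (j i)}"
proof (rule finite_subset)
  show "{multiplicity p (j i) | p i. p \<in> prime_factors (j i)}
      \<subseteq> (\<Union>i. (\<lambda>p. multiplicity p (j i)) ` prime_factors (j i))"
    by blast
qed simp

theorem theorem8p8:
  fixes a b :: "'k::alg_closed_field"
    and as bs :: "'n::finite \<Rightarrow> nat"
  assumes "a * b \<noteq> 0"
    and "\<And>i. as i > 0"
    and "\<And>i. bs i > 0"
    and "\<And>i. coprime (as i) (bs i)"
  shows "absolutely_irreducible (dirichlet_term a as + dirichlet_term b bs) \<longleftrightarrow>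
    Gcd ({multiplicity p (as i) | p i. p \<in> prime_factors (as i)} \<union>
         {multiplicity p (bs i) | p i. p \<in> prime_factors (bs i)}) = 1"
    (is "absolutely_irreducible ?f \<longleftrightarrow> Gcd ?S = 1")
proof -
  have ab: "a \<noteq> 0" "b \<noteq> 0"
    using assms(1) by auto
  let ?x = "Pos_tuple as" and ?y = "Pos_tuple bs"
  have comp: "component ?x i = as i" "component ?y i = bs i" for i
    using assms by (simp_all add: component_Pos_tuple)
  show ?thesis
  proof
    assume irr: "absolutely_irreducible ?f"
    show "Gcd ?S = 1"
    proof (rule ccontr)
      assume "Gcd ?S \<noteq> 1"
      from ex_common_divisor_gt_1[OF this] obtain d where "d > 1" and dvd: "\<forall>s\<in>?S. d dvd s"
        by (elim exE conjE) (rule that)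
      have "d dvd multiplicity p (as i)" if "p \<in> prime_factors (as i)" for p i
        using that by (intro dvd[rule_format]) blast
      then obtain as' where as': "\<And>i. as' i > 0" "as = (\<lambda>i. as' i ^ d)"
        using ex_power_roots[of d as] assms(2) \<open>d > 1\<close> by (metis less_trans zero_less_one)
      have "d dvd multiplicity p (bs i)" if "p \<in> prime_factors (bs i)" for p i
        using that by (intro dvd[rule_format]) blast
      then obtain bs' where bs': "\<And>i. bs' i > 0" "bs = (\<lambda>i. bs' i ^ d)"
        using ex_power_roots[of d bs] assms(3) \<open>d > 1\<close> by (metis less_trans zero_less_one)
      \<comment> \<open>For positive exponents, powers are coprime exactly when their bases
        are.\<close>
      have "coprime (as' i) (bs' i)" for i
        using assms(4)[of i] \<open>d > 1\<close> by (simp add: as'(2) bs'(2))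
      then show False
        using not_absolutely_irreducible_power_binomial[of a b d as' bs']
          ab \<open>d > 1\<close> as'(1) bs'(1) irr
        by (simp add: as'(2) bs'(2))
    qed
  next
    assume Gcd: "Gcd ?S = 1"
    have fin: "finite ?S"
      by (simp add: finite_multiplicities)
    have ex: "\<exists>w. additive_weight w \<and> w ?x - w ?y = int s" if "s \<in> ?S" for s
      using that unfolding Un_iff
    proof
      assume "s \<in> {multiplicity p (as i) | p i. p \<in> prime_factors (as i)}"
      then obtain p i where "s = multiplicity p (as i)" "prime p"
        by auto
      then show ?thesis
        using ex_weight_diff_multiplicity[of p ?x i ?y] assms(4) comp by simp
    next
      assume "s \<in> {multiplicity p (bs i) | p i. p \<in> prime_factors (bs i)}"
      then obtain p i where "s = multiplicity p (bs i)" "prime p"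
        by auto
      \<comment> \<open>The tuples swap roles here, so the resulting weight is negated
        afterwards.\<close>
      then obtain w where "additive_weight w" "w ?y - w ?x = int s"
        using ex_weight_diff_multiplicity[of p ?y i ?x] assms(4) comp
        by (auto simp: coprime_commute)
      then show ?thesis
        by (intro exI[of _ "\<lambda>z. - w z"]) (simp add: additive_weight_def)
    qed
    obtain w where w: "additive_weight w" "w ?x - w ?y = 1"
      using ex_weight_diff_Gcd[OF fin ex] unfolding Gcd by auto
    then have "?x \<noteq> ?y"
      by auto
    then have keys: "Poly_Mapping.keys ?f = {?x, ?y}"
      by (rule keys_dirichlet_binomial[OF ab])
    have "\<not> constant_dirichlet ?f"
      using \<open>?x \<noteq> ?y\<close> by (auto simp: constant_dirichlet_iff keys)
    moreover have "constant_dirichlet g \<or> constant_dirichlet h" if "?f = g * h" for g h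
      using factor_constant_if_weight_diff_1[of g h ?x ?y w] keys that w assms(4) comp by simp
    ultimately show "absolutely_irreducible ?f"
      unfolding absolutely_irreducible_def by blast
  qed
qed

end
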